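(* Let $\mathcal{P}$ be a polygon with boundary word $W(\mathcal{P})=QaRbSa^{-1}Tb^{-1}U$, and suppose that $\mathcal{P}'$ is the polygon with $W(\mathcal{P}')=QTSRUxyx^{-1}y^{-1}$ obtained by applying the handle normalization algorithm once to $\mathcal{P}$. Then $x$ and $y$ are homotopically equivalent to $QTb^{-1}U$ and $U^{-1}R^{-1}a^{-1}Tb^{-1}U$, respectively.
   Context: $\mathcal{P}$ is an even-sided polygon with side-pairing given by its reduced boundary word, read counter-clockwise, whose quotient is a closed orientable surface; $a,b$ are letters and $Q,R,S,T,U$ are (possibly empty) words. Homotopy is in the quotient surface, in which words are read as edge paths. The handle normalization algorithm consists of three cut-and-paste steps on $\mathcal{P}$. (1) Cut $\mathcal{P}$ along the diagonal $d$ joining the vertex between $S$ and $a^{-1}$ (the end point of $a$) to the common vertex of $Q$ and $U$, obtaining polygons with words $QaRbSd$ and $d^{-1}a^{-1}Tb^{-1}U$, and glue along $a$ to get $d^{-1}RbSdQTb^{-1}U$. (2) Cut this polygon along the diagonal $e$ that separates it into polygons with words $d^{-1}RbSde$ and $e^{-1}QTb^{-1}U$, and glue along $b$ to get $d^{-1}RUe^{-1}QTSde$. (3) Cut this polygon along the diagonal $f$ that separates it into polygons with words $d^{-1}RUf$ and $f^{-1}e^{-1}QTSde$, and glue along $d$ to get $QTSRUfef^{-1}e^{-1}$. The two new letters are then renamed so that the resulting word is written $QTSRUxyx^{-1}y^{-1}$.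
   Formalization: The new letters are interchanged in the final word: it is QTSRUyxy^{-1}x^{-1}, with x the second diagonal e and y the third f. With the printed word xyx^{-1}y^{-1} the claim fails for the torus aba^{-1}b^{-1}, where x would be homotopic to a^{-1}b^{-1}, not b^{-1}. *)

theory Defs
  imports "HOL-Analysis.Analysis"
begin

section \<open>Words\<close>

text \<open>A signed letter \<open>(l, True)\<close> stands for \<open>l\<close>, and \<open>(l, False)\<close> for its inverse.\<close>

type_synonym 'l sletter = "'l \<times> bool"

definition inv_letter :: "'l sletter \<Rightarrow> 'l sletter" where
  "inv_letter s = (fst s, \<not> snd s)"

definition inv_word :: "'l sletter list \<Rightarrow> 'l sletter list" where
  "inv_word w = rev (map inv_letter w)"

text \<open>Every letter that occurs in the word occurs exactly twice, once with each sign; this is the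
  condition on the side-pairing for the quotient to be a closed orientable surface.\<close>

definition orientable_pairing :: "'l sletter list \<Rightarrow> bool" where
  "orientable_pairing w \<longleftrightarrow> w \<noteq> [] \<and> distinct w \<and> (\<forall>s\<in>set w. inv_letter s \<in> set w)"

text \<open>Boundary words are cyclic, so the last and the first letter count as adjacent.\<close>

definition cyc_reduced :: "'l sletter list \<Rightarrow> bool" where
  "cyc_reduced w \<longleftrightarrow> (\<forall>i<length w. w ! (Suc i mod length w) \<noteq> inv_letter (w ! i))"

section \<open>Polygons and their quotient surfaces\<close>

text \<open>The model of an \<open>n\<close>-gon is the closed unit disc with its boundary circle divided into \<open>n\<close> equal
  arcs, numbered and parametrised counter-clockwise. A straight-sided convex polygon would not do:
  cutting along a diagonal may produce a bigon, for instance \<open>e\<inverse>QTb\<inverse>U\<close> with \<open>Q\<close>, \<open>T\<close>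
  and \<open>U\<close> empty.\<close>

abbreviation disc :: "complex set" where
  "disc \<equiv> cball 0 1"

definition side :: "nat \<Rightarrow> nat \<Rightarrow> real \<Rightarrow> complex" where
  "side n k t = cis (2 * pi * (real k + t) / real n)"

text \<open>A polygon comes with a map from the disc into a space; for the original polygon this is the
  quotient map onto its surface. All polygons produced by cutting and pasting carry maps into that
  same surface, which makes edge paths of different polygons comparable.\<close>

record ('l, 's) polygon =
  bword :: "'l sletter list"
  proj :: "complex \<Rightarrow> 's"

abbreviation nsides :: "('l, 's) polygon \<Rightarrow> nat" where
  "nsides P \<equiv> length (bword P)"

definition identified :: "'l sletter list \<Rightarrow> complex \<Rightarrow> complex \<Rightarrow> bool" where
  "identified w = equivclp (\<lambda>z z'. \<exists>i<length w. \<exists>j<length w. \<exists>t\<in>{0..1}.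
     w ! j = inv_letter (w ! i) \<and> z = side (length w) i t \<and> z' = side (length w) j (1 - t))"

text \<open>\<open>M\<close>, with the projection of \<open>P\<close>, is the quotient of the polygon by its side-pairing.\<close>

definition quotient_surface :: "('l, 's::topological_space) polygon \<Rightarrow> 's set \<Rightarrow> bool" where
  "quotient_surface P M \<longleftrightarrow>
     orientable_pairing (bword P) \<and>
     quotient_map (top_of_set disc) (top_of_set M) (proj P) \<and>
     (\<forall>z\<in>disc. \<forall>z'\<in>disc. proj P z = proj P z' \<longleftrightarrow> identified (bword P) z z')"

text \<open>The path in the surface traced by the side that carries a given signed letter.\<close>

definition letter_path :: "('l, 's) polygon \<Rightarrow> 'l sletter \<Rightarrow> real \<Rightarrow> 's" where
  "letter_path P s = proj P \<circ> side (nsides P) (THE i. i < nsides P \<and> bword P ! i = s)"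

text \<open>The edge path read off from a nonempty word, traversed from left to right. The empty word has
  no edge path of its own, since its base point is not determined.\<close>

fun edge_path :: "('l, 's::topological_space) polygon \<Rightarrow> 'l sletter list \<Rightarrow> real \<Rightarrow> 's" where
  "edge_path P [s] = letter_path P s"
| "edge_path P (s # t # ss) = letter_path P s +++ edge_path P (t # ss)"

section \<open>Cutting and pasting\<close>

text \<open>The same polygon, with the boundary word read from another starting vertex.\<close>

definition rotated :: "('l, 's) polygon \<Rightarrow> ('l, 's) polygon \<Rightarrow> bool" where
  "rotated P P' \<longleftrightarrow> (\<exists>k. bword P' = rotate k (bword P) \<and>
     (\<forall>z\<in>disc. proj P' z = proj P (z * cis (2 * pi * real k / real (nsides P)))))"

definition embeds_via :: "(complex \<Rightarrow> complex) \<Rightarrow> ('l, 's) polygon \<Rightarrow> ('l, 's) polygon \<Rightarrow> bool" where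
  "embeds_via g A P \<longleftrightarrow> continuous_on disc g \<and> inj_on g disc \<and> g ` disc \<subseteq> disc \<and>
     (\<forall>z\<in>disc. proj A z = proj P (g z))"

text \<open>\<open>cut d P A B\<close>: the polygon \<open>P\<close> with word \<open>uv\<close> is cut into the polygons \<open>A\<close> and \<open>B\<close> with words
  \<open>ud\<close> and \<open>d\<inverse>v\<close>. The diagonal \<open>d\<close> runs from the vertex between \<open>u\<close> and \<open>v\<close> to the initial vertex.
  The pieces are embedded in \<open>P\<close> by \<open>g\<close> and \<open>h\<close>, side by side, they cover \<open>P\<close>, and they meet
  exactly in the diagonal.\<close>

definition cut :: "'l sletter \<Rightarrow> ('l, 's) polygon \<Rightarrow> ('l, 's) polygon \<Rightarrow> ('l, 's) polygon \<Rightarrow> bool" where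
  "cut d P A B \<longleftrightarrow> (\<exists>u v g h.
     u \<noteq> [] \<and> v \<noteq> [] \<and> bword P = u @ v \<and> fst d \<notin> fst ` set (bword P) \<and>
     bword A = u @ [d] \<and> bword B = inv_letter d # v \<and>
     embeds_via g A P \<and> embeds_via h B P \<and>
     g ` disc \<union> h ` disc = disc \<and>
     g ` disc \<inter> h ` disc = g ` side (nsides A) (length u) ` {0..1} \<and>
     (\<forall>t\<in>{0..1}.
        (\<forall>i<length u. g (side (nsides A) i t) = side (nsides P) i t) \<and>
        (\<forall>i<length v. h (side (nsides B) (Suc i) t) = side (nsides P) (length u + i) t) \<and>
        g (side (nsides A) (length u) t) = h (side (nsides B) 0 (1 - t))))"

text \<open>Gluing a side \<open>a\<close> of \<open>A\<close> to the side \<open>a\<inverse>\<close> of \<open>B\<close> gives a polygon that, after choosing initial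
  vertices, is cut back into \<open>A\<close> and \<open>B\<close> by the diagonal \<open>a\<close>.\<close>

definition glue :: "'l sletter \<Rightarrow> ('l, 's) polygon \<Rightarrow> ('l, 's) polygon \<Rightarrow> ('l, 's) polygon \<Rightarrow> bool" where
  "glue a A B P \<longleftrightarrow> (\<exists>A' B' P'. rotated A A' \<and> rotated B B' \<and> cut a P' A' B' \<and> rotated P' P)"

text \<open>The three steps of the handle normalization algorithm, introducing the diagonals \<open>d\<close>, \<open>e\<close> and
  \<open>f\<close>, in this order. In the third step the side \<open>d\<close> belongs to the second piece.

  The final word lists the new letters as \<open>fef\<inverse>e\<inverse>\<close>, the later diagonal first. With
  \<open>x = e\<close> and \<open>y = f\<close>, the naming for which \<open>x\<close> and \<open>y\<close> are homotopic to \<open>QTb\<inverse>U\<close> and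
  \<open>U\<inverse>R\<inverse>a\<inverse>Tb\<inverse>U\<close>, respectively, it ends in \<open>yxy\<inverse>x\<inverse>\<close> rather than \<open>xyx\<inverse>y\<inverse>\<close>. With \<open>x\<close>
  and \<open>y\<close> exchanged the homotopies fail already for the torus \<open>aba\<inverse>b\<inverse>\<close>, where \<open>f\<close> is
  homotopic to \<open>a\<inverse>b\<inverse>\<close> and \<open>e\<close> to \<open>b\<inverse>\<close>.\<close>

definition handle_normalization ::
  "('l, 's) polygon \<Rightarrow> 'l sletter list \<Rightarrow> 'l sletter \<Rightarrow> 'l sletter list \<Rightarrow> 'l sletter \<Rightarrow>
   'l sletter list \<Rightarrow> 'l sletter list \<Rightarrow> 'l sletter list \<Rightarrow>
   'l sletter \<Rightarrow> 'l sletter \<Rightarrow> 'l sletter \<Rightarrow> ('l, 's) polygon \<Rightarrow> bool" where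
  "handle_normalization P Q a R b S T U d e f P' \<longleftrightarrow> (\<exists>A1 B1 P1 A2 B2 P2 A3 B3.
     bword P = Q @ [a] @ R @ [b] @ S @ [inv_letter a] @ T @ [inv_letter b] @ U \<and>

     cut d P A1 B1 \<and>
     bword A1 = Q @ [a] @ R @ [b] @ S @ [d] \<and>
     bword B1 = [inv_letter d, inv_letter a] @ T @ [inv_letter b] @ U \<and>
     glue a A1 B1 P1 \<and>
     bword P1 = [inv_letter d] @ R @ [b] @ S @ [d] @ Q @ T @ [inv_letter b] @ U \<and>

     cut e P1 A2 B2 \<and>
     bword A2 = [inv_letter d] @ R @ [b] @ S @ [d, e] \<and>
     bword B2 = [inv_letter e] @ Q @ T @ [inv_letter b] @ U \<and>
     glue b A2 B2 P2 \<and>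
     bword P2 = [inv_letter d] @ R @ U @ [inv_letter e] @ Q @ T @ S @ [d, e] \<and>

     cut f P2 A3 B3 \<and>
     bword A3 = [inv_letter d] @ R @ U @ [f] \<and>
     bword B3 = [inv_letter f, inv_letter e] @ Q @ T @ S @ [d, e] \<and>
     glue d B3 A3 P' \<and>
     bword P' = Q @ T @ S @ R @ U @ [f, e, inv_letter f, inv_letter e])"

end

theory Submission
  imports Defs
begin

text \<open>Cutting and pasting changes the polygon but not the surface: a side that survives a cut or a
  gluing still traces the same path in \<open>M\<close> (\<open>cut_same_path\<close>, \<open>glue_same_path\<close>). The only new
  letters are the diagonals, and a diagonal of a polygon with word \<open>uv\<close> that separates \<open>u\<close> from \<open>v\<close>
  is homotopic both to \<open>u\<inverse>\<close> and to \<open>v\<close>, because each of the two pieces is a disc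
  (\<open>cut_diagonal_homotopic\<close>).

  Reading the three cuts in this way gives the result. The first diagonal \<open>d\<close> separates
  \<open>QaRbS\<close> from \<open>a\<inverse>Tb\<inverse>U\<close>, so \<open>d\<close> is homotopic to \<open>a\<inverse>Tb\<inverse>U\<close>. The second one,
  \<open>x\<close>, separates \<open>d\<inverse>RbSd\<close> from \<open>QTb\<inverse>U\<close>, so \<open>x\<close> is homotopic to \<open>QTb\<inverse>U\<close>, a
  word in letters of the original polygon. The third one, \<open>y\<close>, cuts off \<open>d\<inverse>RU\<close>, so \<open>y\<close> is
  homotopic to \<open>(d\<inverse>RU)\<inverse> = U\<inverse>R\<inverse>d\<close>, and substituting the class of \<open>d\<close> gives
  \<open>U\<inverse>R\<inverse>a\<inverse>Tb\<inverse>U\<close>.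

  Two points need care. The homotopies have to take place in \<open>M\<close>, so the maps of all
  intermediate polygons have to be continuous with values in \<open>M\<close>; for a glued polygon this follows
  by pasting the maps of its pieces. And the last substitution mixes letters of different polygons,
  so that the edge paths of \<open>RU\<close> and its inverse have to be compared between the polygon in which
  \<open>RU\<close> is part of the boundary and the original one, in which \<open>R\<close> and \<open>U\<close> are apart.\<close>

section \<open>Letters, words and sides\<close>

lemma inv_letter_inv_letter [simp]: "inv_letter (inv_letter s) = s"
  by (simp add: inv_letter_def)

lemma inv_letter_eq_iff [simp]: "inv_letter s = inv_letter t \<longleftrightarrow> s = t"
  by (metis inv_letter_inv_letter)

lemma fst_inv_letter [simp]: "fst (inv_letter s) = fst s"
  by (simp add: inv_letter_def)

lemma inv_letter_neq [simp]: "inv_letter s \<noteq> s" "s \<noteq> inv_letter s"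
  by (auto simp: inv_letter_def prod_eq_iff)

lemma inv_word_Nil [simp]: "inv_word [] = []"
  by (simp add: inv_word_def)

lemma inv_word_Cons: "inv_word (s # w) = inv_word w @ [inv_letter s]"
  by (simp add: inv_word_def)

lemma inv_word_append: "inv_word (u @ v) = inv_word v @ inv_word u"
  by (simp add: inv_word_def)

lemma inv_word_eq_Nil [simp]: "inv_word w = [] \<longleftrightarrow> w = []"
  by (simp add: inv_word_def)

lemma last_inv_word: "w \<noteq> [] \<Longrightarrow> last (inv_word w) = inv_letter (hd w)"
  by (cases w) (auto simp: inv_word_Cons)

lemma norm_side [simp]: "norm (side n k t) = 1"
  by (simp add: side_def)

lemma side_1: "side n k 1 = side n (Suc k) 0"
  by (simp add: side_def add.commute)

lemma pathstart_side: "pathstart (side n k) = side n k 0"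
  by (simp add: pathstart_def)

lemma pathfinish_side: "pathfinish (side n k) = side n (Suc k) 0"
  by (simp add: pathfinish_def side_1)

lemma side_full_turn: "n > 0 \<Longrightarrow> side n n 0 = side n 0 0"
  by (simp add: side_def)

lemma side_mult_cis: "side n i t * cis (2 * pi * real k / real n) = side n (i + k) t"
  by (simp add: side_def cis_mult add_divide_distrib algebra_simps)

lemma side_add_period: "n > 0 \<Longrightarrow> side n (k + n * m) t = side n k t"
proof -
  assume n: "n > 0"
  have "2 * pi * (real (k + n * m) + t) / real n
      = 2 * pi * (real k + t) / real n + 2 * pi * real m"
    using n by (simp add: field_simps)
  then show ?thesis
    unfolding side_def by (simp flip: cis_mult)
qed

lemma side_mod: "n > 0 \<Longrightarrow> side n (k mod n) t = side n k t"
  using side_add_period[of n "k mod n" "k div n" t] by simp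

lemma path_side: "path (side n k)"
  unfolding path_def side_def by (cases "n = 0") (auto intro!: continuous_intros)

lemma path_image_side: "path_image (side n k) \<subseteq> disc"
  by (auto simp: path_image_def)

section \<open>Edge paths\<close>

lemma edge_path_Cons:
  "w \<noteq> [] \<Longrightarrow> edge_path P (s # w) = letter_path P s +++ edge_path P w"
  by (cases w) auto

text \<open>Agreement is required only on the unit interval, since letter paths are also defined outside
  it, where they run on into neighbouring sides that cutting and gluing do change.\<close>

definition same_path :: "('l, 's::topological_space) polygon \<Rightarrow> ('l, 's) polygon \<Rightarrow> 'l sletter \<Rightarrow> bool" where
  "same_path A B s \<longleftrightarrow> (\<forall>t\<in>{0..1}. letter_path A s t = letter_path B s t)"

lemma same_path_sym: "same_path A B s \<Longrightarrow> same_path B A s"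
  by (simp add: same_path_def)

lemma same_path_trans: "same_path A B s \<Longrightarrow> same_path B C s \<Longrightarrow> same_path A C s"
  by (simp add: same_path_def)

lemma edge_path_cong:
  assumes "w \<noteq> []" "\<And>s. s \<in> set w \<Longrightarrow> same_path A B s" "t \<in> {0..1}"
  shows "edge_path A w t = edge_path B w t"
  using assms
proof (induction w arbitrary: t rule: list_nonempty_induct)
  case (single s)
  then show ?case by (simp add: same_path_def)
next
  case (cons s w)
  have "letter_path A s r = letter_path B s r" if "r \<in> {0..1}" for r
    using cons.prems(1)[of s] that by (simp add: same_path_def)
  moreover have "edge_path A w r = edge_path B w r" if "r \<in> {0..1}" for r
    using cons.IH[of r] cons.prems(1) that by simp
  ultimately show ?case
    using cons.prems(2) cons.hyps by (simp add: edge_path_Cons joinpaths_def)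
qed

text \<open>The composability condition under which \<^const>\<open>edge_path\<close> is a path in \<open>M\<close>. It is needed
  as a notion of its own because the words of the final comparison are not all parts of the boundary
  word of a single polygon.\<close>

definition walk :: "'s::topological_space set \<Rightarrow> ('l, 's) polygon \<Rightarrow> 'l sletter list \<Rightarrow> bool" where
  "walk M P w \<longleftrightarrow> (\<forall>s\<in>set w. path (letter_path P s) \<and> path_image (letter_path P s) \<subseteq> M) \<and>
     successively (\<lambda>s t. pathfinish (letter_path P s) = pathstart (letter_path P t)) w"

lemma walk_Cons:
  "walk M P (s # w) \<longleftrightarrow> path (letter_path P s) \<and> path_image (letter_path P s) \<subseteq> M \<and> walk M P w \<and>
     (w \<noteq> [] \<longrightarrow> pathfinish (letter_path P s) = pathstart (letter_path P (hd w)))"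
  by (cases w) (auto simp: walk_def)

lemma walk_append:
  "walk M P (u @ v) \<longleftrightarrow> walk M P u \<and> walk M P v \<and>
     (u \<noteq> [] \<longrightarrow> v \<noteq> [] \<longrightarrow>
       pathfinish (letter_path P (last u)) = pathstart (letter_path P (hd v)))"
  by (auto simp: walk_def successively_append_iff)

lemma walk_cong:
  assumes "walk M A w" "\<And>s. s \<in> set w \<Longrightarrow> same_path A B s"
  shows "walk M B w"
  using assms
proof (induction w)
  case (Cons s w)
  have hom: "homotopic_paths M (letter_path A r) (letter_path B r)" if "r = s \<or> r \<in> set w" for r
    using Cons.prems(1) Cons.prems(2)[of r] that
    by (intro homotopic_paths_eq) (auto simp: walk_def same_path_def)
  note start = homotopic_paths_imp_pathstart[OF hom] and finish = homotopic_paths_imp_pathfinish[OF hom]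
  have "pathfinish (letter_path B s) = pathstart (letter_path B (hd w))" if "w \<noteq> []"
    using Cons.prems(1) that finish[of s] start[of "hd w"] by (simp add: walk_Cons)
  then show ?case
    using Cons homotopic_paths_imp_path[OF hom[of s]] homotopic_paths_imp_subset[OF hom[of s]]
    by (simp add: walk_Cons)
qed (simp add: walk_def)

lemma walk_edge_path:
  assumes "w \<noteq> []" "walk M P w"
  shows "path (edge_path P w)" "path_image (edge_path P w) \<subseteq> M"
    "pathstart (edge_path P w) = pathstart (letter_path P (hd w))"
    "pathfinish (edge_path P w) = pathfinish (letter_path P (last w))"
proof -
  have "path (edge_path P w) \<and> path_image (edge_path P w) \<subseteq> M \<and>
    pathstart (edge_path P w) = pathstart (letter_path P (hd w)) \<and>
    pathfinish (edge_path P w) = pathfinish (letter_path P (last w))"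
    using assms
  proof (induction w rule: list_nonempty_induct)
    case (single s)
    then show ?case by (simp add: walk_def)
  next
    case (cons s w)
    then show ?case
      by (simp add: edge_path_Cons walk_Cons path_join subset_path_image_join)
  qed
  then show "path (edge_path P w)" "path_image (edge_path P w) \<subseteq> M"
    "pathstart (edge_path P w) = pathstart (letter_path P (hd w))"
    "pathfinish (edge_path P w) = pathfinish (letter_path P (last w))"
    by auto
qed

text \<open>Only a homotopy and not an equation: the two sides bracket the joins differently.\<close>

lemma edge_path_append:
  assumes "u \<noteq> []" "v \<noteq> []" "walk M P (u @ v)"
  shows "homotopic_paths M (edge_path P (u @ v)) (edge_path P u +++ edge_path P v)"
  using assms
proof (induction u rule: list_nonempty_induct)
  case (single s)
  then show ?case
    using walk_edge_path[OF _ single(2)]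
    by (simp add: edge_path_Cons)
next
  case (cons s u)
  have w: "walk M P (u @ v)" "walk M P (s # u)" "walk M P u" "walk M P v"
    using cons.prems by (auto simp: walk_Cons walk_append)
  have s: "path (letter_path P s)" "path_image (letter_path P s) \<subseteq> M"
     "pathfinish (letter_path P s) = pathstart (letter_path P (hd u))"
    using cons.prems cons.hyps by (auto simp: walk_Cons)
  note eu = walk_edge_path[OF cons.hyps w(3)]
  note ev = walk_edge_path[OF cons.prems(1) w(4)]
  note euv = walk_edge_path[OF _ w(1)]
  have uv: "pathfinish (letter_path P (last u)) = pathstart (letter_path P (hd v))"
    using w(1) cons by (simp add: walk_append)
  have "homotopic_paths M (letter_path P s +++ edge_path P (u @ v))
          (letter_path P s +++ (edge_path P u +++ edge_path P v))"
    using cons.IH cons.prems w(1) s euv cons.hyps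
    by (intro homotopic_paths_join) auto
  moreover have "homotopic_paths M (letter_path P s +++ (edge_path P u +++ edge_path P v))
       ((letter_path P s +++ edge_path P u) +++ edge_path P v)"
    using s eu ev uv by (intro homotopic_paths_assoc) auto
  ultimately show ?case
    using cons.hyps by (auto simp: edge_path_Cons intro: homotopic_paths_trans)
qed

text \<open>The hypothesis on inverse letters is a homotopy because in a quotient by the side-pairing the
  two paths agree only on the unit interval.\<close>

lemma walk_inv_word:
  assumes "walk M P w"
    and "\<And>s. s \<in> set w \<Longrightarrow>
      homotopic_paths M (letter_path P (inv_letter s)) (reversepath (letter_path P s))"
  shows "walk M P (inv_word w)"
  using assms
proof (induction w)
  case (Cons s w)
  have w: "walk M P (inv_word w)" "walk M P w"
    using Cons by (auto simp: walk_Cons)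
  have inv: "homotopic_paths M (letter_path P (inv_letter r)) (reversepath (letter_path P r))"
    if "r = s \<or> r \<in> set w" for r
    using Cons.prems(2) that by auto
  have s: "walk M P [inv_letter s]"
    using homotopic_paths_imp_path[OF inv[of s]] homotopic_paths_imp_subset[OF inv[of s]]
    by (simp add: walk_def)
  have "pathfinish (letter_path P (last (inv_word w))) = pathstart (letter_path P (inv_letter s))"
    if "w \<noteq> []"
    using homotopic_paths_imp_pathfinish[OF inv[of "hd w"]]
      homotopic_paths_imp_pathstart[OF inv[of s]] that Cons.prems(1)
    by (simp add: last_inv_word walk_Cons)
  then show ?case
    using w s by (simp add: inv_word_Cons walk_append)
qed (simp add: walk_def)

lemma edge_path_inv_word:
  assumes "w \<noteq> []" "walk M P w"
    and "\<And>s. s \<in> set w \<Longrightarrow>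
      homotopic_paths M (letter_path P (inv_letter s)) (reversepath (letter_path P s))"
  shows "homotopic_paths M (edge_path P (inv_word w)) (reversepath (edge_path P w))"
  using assms
proof (induction w rule: list_nonempty_induct)
  case (single s)
  then show ?case by (simp add: inv_word_Cons)
next
  case (cons s w)
  have w: "walk M P w" using cons.prems by (simp add: walk_Cons)
  have s: "pathfinish (letter_path P s) = pathstart (letter_path P (hd w))"
    using cons.prems cons.hyps by (auto simp: walk_Cons)
  note ew = walk_edge_path[OF cons.hyps w]
  have "walk M P (inv_word (s # w))"
    using cons.prems by (intro walk_inv_word) auto
  then have "homotopic_paths M (edge_path P (inv_word (s # w)))
          (edge_path P (inv_word w) +++ letter_path P (inv_letter s))"
    using edge_path_append[of "inv_word w" "[inv_letter s]" M P] cons.hyps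
    by (simp add: inv_word_Cons)
  also have "homotopic_paths M (edge_path P (inv_word w) +++ letter_path P (inv_letter s))
      (reversepath (edge_path P w) +++ reversepath (letter_path P s))"
  proof (rule homotopic_paths_join)
    show h: "homotopic_paths M (edge_path P (inv_word w)) (reversepath (edge_path P w))"
      using cons.IH cons.prems w by simp
    show h': "homotopic_paths M (letter_path P (inv_letter s)) (reversepath (letter_path P s))"
      using cons.prems by simp
    show "pathfinish (edge_path P (inv_word w)) = pathstart (letter_path P (inv_letter s))"
      using homotopic_paths_imp_pathfinish[OF h] homotopic_paths_imp_pathstart[OF h'] s ew by simp
  qed
  also have "reversepath (edge_path P w) +++ reversepath (letter_path P s)
      = reversepath (edge_path P (s # w))"
    using s ew cons.hyps by (simp add: edge_path_Cons reversepath_joinpaths)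
  finally show ?case .
qed

section \<open>Polygons mapped into a surface\<close>

text \<open>What all polygons in the algorithm have in common with the original one. The quotient property
  itself is not kept, since the pieces of a cut need not cover \<open>M\<close>.\<close>

definition polygon_over :: "'s::topological_space set \<Rightarrow> ('l, 's) polygon \<Rightarrow> bool" where
  "polygon_over M P \<longleftrightarrow> distinct (bword P) \<and> continuous_on disc (proj P) \<and> proj P ` disc \<subseteq> M"

lemma quotient_surface_imp_polygon_over:
  "quotient_surface P M \<Longrightarrow> polygon_over M P"
  unfolding quotient_surface_def polygon_over_def orientable_pairing_def
  using quotient_imp_continuous_map[of "top_of_set disc" "top_of_set M" "proj P"]
  by (auto simp del: mem_cball)

lemma letter_path_nth:
  assumes "distinct (bword P)" "i < nsides P"
  shows "letter_path P (bword P ! i) = proj P \<circ> side (nsides P) i"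
proof -
  have "(THE j. j < nsides P \<and> bword P ! j = bword P ! i) = i"
    using assms by (intro the_equality) (auto simp: nth_eq_iff_index_eq)
  then show ?thesis by (simp add: letter_path_def)
qed

text \<open>The disc is convex, so every stretch of the boundary can be contracted to the chord between
  its end points. All other homotopies in the argument come from formal properties of joining
  paths or from equality on the unit interval.\<close>

lemma edge_path_homotopic_chord:
  assumes P: "polygon_over M P" and w: "bword P = p @ u @ q" and "u \<noteq> []"
  defines "V \<equiv> \<lambda>k. side (nsides P) k 0"
  shows "homotopic_paths M (edge_path P u)
           (proj P \<circ> linepath (V (length p)) (V (length p + length u)))"
  using \<open>u \<noteq> []\<close> w
proof (induction u arbitrary: p rule: list_nonempty_induct)
  have push: "homotopic_paths M (proj P \<circ> \<alpha>) (proj P \<circ> \<beta>)"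
    if "path \<alpha>" "path \<beta>" "path_image \<alpha> \<subseteq> disc" "path_image \<beta> \<subseteq> disc"
       "pathstart \<alpha> = pathstart \<beta>" "pathfinish \<alpha> = pathfinish \<beta>" for \<alpha> \<beta>
  proof -
    have "homotopic_paths disc \<alpha> \<beta>"
      using that unfolding path_image_def
      by (intro homotopic_paths_linear closed_segment_subset[OF _ _ convex_cball])
        (auto simp only: image_subset_iff)
    then show ?thesis
      using P unfolding polygon_over_def
      by (intro homotopic_paths_continuous_image) (auto simp: image_subset_iff_funcset)
  qed
  have [simp]: "norm (V k) = 1" for k by (simp add: V_def)
  have seg: "closed_segment (V i) (V j) \<subseteq> disc" for i j
    by (rule closed_segment_subset) auto
  have letter: "homotopic_paths M (letter_path P s)
      (proj P \<circ> linepath (V (length p)) (V (Suc (length p))))"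
    if "bword P = p @ s # q" for s p q
  proof -
    have "letter_path P s = proj P \<circ> side (nsides P) (length p)"
      using letter_path_nth[of P "length p"] that P by (simp add: polygon_over_def)
    moreover have "homotopic_paths M (proj P \<circ> side (nsides P) (length p))
      (proj P \<circ> linepath (V (length p)) (V (Suc (length p))))"
      using path_side path_image_side seg
      by (intro push) (auto simp: pathstart_side pathfinish_side V_def)
    ultimately show ?thesis by simp
  qed
  {
    case (single s)
    then show ?case using letter[of p s q] by (simp add: o_def)
  next
    case (cons s u)
    have 1: "homotopic_paths M (letter_path P s)
      (proj P \<circ> linepath (V (length p)) (V (Suc (length p))))"
      using letter[of p s "u @ q"] cons.prems by simp
    have 2: "homotopic_paths M (edge_path P u)
      (proj P \<circ> linepath (V (Suc (length p))) (V (Suc (length p) + length u)))"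
      using cons.IH[of "p @ [s]"] cons.prems by (simp add: o_def)
    have "homotopic_paths M (letter_path P s +++ edge_path P u)
       ((proj P \<circ> linepath (V (length p)) (V (Suc (length p)))) +++
        (proj P \<circ> linepath (V (Suc (length p))) (V (Suc (length p) + length u))))"
      using homotopic_paths_imp_pathfinish[OF 1] homotopic_paths_imp_pathstart[OF 2]
      by (intro homotopic_paths_join[OF 1 2]) (simp add: pathstart_compose pathfinish_compose)
    also have "\<dots> = proj P \<circ> (linepath (V (length p)) (V (Suc (length p))) +++
        linepath (V (Suc (length p))) (V (Suc (length p) + length u)))"
      by (simp add: path_compose_join)
    also have "homotopic_paths M \<dots>
        (proj P \<circ> linepath (V (length p)) (V (Suc (length p) + length u)))"
      using seg by (intro push) (auto simp: path_image_join)
    finally show ?case using cons.hyps by (simp add: edge_path_Cons o_def)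
  }
qed

lemma walk_bword_factor:
  assumes P: "polygon_over M P" and w: "bword P = p @ u @ q"
  shows "walk M P u"
  using w
proof (induction u arbitrary: p)
  case Nil
  then show ?case by (simp add: walk_def)
next
  case (Cons s u)
  note chord = edge_path_homotopic_chord[OF P]
  have s: "homotopic_paths M (letter_path P s)
     (proj P \<circ> linepath (side (nsides P) (length p) 0) (side (nsides P) (Suc (length p)) 0))"
    using chord[of p "[s]" "u @ q"] Cons.prems by simp
  have "pathstart (letter_path P (hd u)) = proj P (side (nsides P) (Suc (length p)) 0)"
    if "u \<noteq> []"
  proof -
    have "bword P = (p @ [s]) @ [hd u] @ (tl u @ q)"
      using Cons.prems that by simp
    from homotopic_paths_imp_pathstart[OF chord[OF this]] show ?thesis
      by (simp add: pathstart_compose)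
  qed
  then show ?case
    using Cons.IH[of "p @ [s]"] Cons.prems homotopic_paths_imp_path[OF s]
      homotopic_paths_imp_subset[OF s] homotopic_paths_imp_pathfinish[OF s]
    by (auto simp: walk_Cons pathfinish_compose)
qed

lemma walk_letter:
  assumes "polygon_over M P" "s \<in> set (bword P)"
  shows "path (letter_path P s)" "path_image (letter_path P s) \<subseteq> M"
proof -
  obtain p q where "bword P = p @ [s] @ q"
    using split_list[OF assms(2)] by auto
  then have "walk M P [s]" using walk_bword_factor[OF assms(1)] by blast
  then show "path (letter_path P s)" "path_image (letter_path P s) \<subseteq> M"
    by (auto simp: walk_def)
qed

lemma letter_path_inv_letter:
  assumes "quotient_surface P M" "s \<in> set (bword P)"
  shows "homotopic_paths M (letter_path P (inv_letter s)) (reversepath (letter_path P s))"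
proof -
  let ?w = "bword P"
  have d: "distinct ?w" and inv_in: "inv_letter s \<in> set ?w"
    using assms by (auto simp: quotient_surface_def orientable_pairing_def)
  then obtain i j where ij: "i < nsides P" "?w ! i = s" "j < nsides P" "?w ! j = inv_letter s"
    using assms(2) by (metis in_set_conv_nth)
  have eq: "letter_path P (inv_letter s) t = reversepath (letter_path P s) t"
    if t: "t \<in> {0..1}" for t
  proof -
    have "identified ?w (side (nsides P) i (1 - t)) (side (nsides P) j (1 - (1 - t)))"
      unfolding identified_def using ij t
      by (intro r_into_equivclp exI[of _ i] exI[of _ j] conjI bexI[of _ "1 - t"]) auto
    then have "proj P (side (nsides P) i (1 - t)) = proj P (side (nsides P) j t)"
      using assms(1) by (simp add: quotient_surface_def)
    then show ?thesis
      using letter_path_nth[OF d ij(1)] letter_path_nth[OF d ij(3)] ij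
      by (simp add: reversepath_def)
  qed
  note inv = walk_letter[OF quotient_surface_imp_polygon_over[OF assms(1)] inv_in]
  show ?thesis
    using inv eq by (intro homotopic_paths_eq) auto
qed

section \<open>Cutting and gluing keep the paths of the surviving sides\<close>

lemma rotated_polygon_over:
  assumes "rotated P P'" "polygon_over M P"
  shows "polygon_over M P'"
proof -
  obtain k where k: "bword P' = rotate k (bword P)"
     "\<And>z. z \<in> disc \<Longrightarrow> proj P' z = proj P (z * cis (2 * pi * real k / real (nsides P)))"
    using assms(1) unfolding rotated_def by blast
  let ?r = "\<lambda>z. z * cis (2 * pi * real k / real (nsides P))"
  have r: "?r ` disc \<subseteq> disc" by (auto simp: norm_mult)
  have "continuous_on disc (\<lambda>z. proj P (?r z))"
    using assms(2) r unfolding polygon_over_def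
    by (intro continuous_on_compose2[of disc "proj P" disc ?r] continuous_intros) auto
  then have "continuous_on disc (proj P')"
    by (rule continuous_on_eq) (simp add: k(2))
  moreover have "proj P' ` disc \<subseteq> M"
    using k(2) r assms(2) unfolding polygon_over_def by (auto simp: image_subset_iff)
  ultimately show ?thesis
    using k(1) assms(2) by (simp add: polygon_over_def)
qed

lemma rotated_set_bword: "rotated P P' \<Longrightarrow> set (bword P') = set (bword P)"
  and rotated_distinct: "rotated P P' \<Longrightarrow> distinct (bword P') = distinct (bword P)"
  by (auto simp: rotated_def)

lemma rotated_same_path:
  assumes "rotated P P'" "distinct (bword P)" "s \<in> set (bword P)"
  shows "same_path P' P s"
proof -
  obtain k where k: "bword P' = rotate k (bword P)"
     "\<And>z. z \<in> disc \<Longrightarrow> proj P' z = proj P (z * cis (2 * pi * real k / real (nsides P)))"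
    using assms(1) unfolding rotated_def by blast
  let ?n = "nsides P"
  have "s \<in> set (bword P')" using assms(3) k(1) by simp
  then obtain i where i: "i < nsides P'" "bword P' ! i = s"
    by (auto simp: in_set_conv_nth)
  have n: "nsides P' = ?n" "?n > 0" using k(1) i by auto
  have s: "s = bword P ! ((i + k) mod ?n)"
    using i k(1) by (simp add: nth_rotate add.commute)
  have "letter_path P' s = proj P' \<circ> side ?n i"
    using letter_path_nth[of P' i] i n k(1) assms(2) by simp
  moreover have "letter_path P s = proj P \<circ> side ?n (i + k)"
    using letter_path_nth[OF assms(2), of "(i + k) mod ?n"] n s by (simp add: side_mod o_def)
  ultimately show ?thesis
    by (simp add: same_path_def k(2) side_mult_cis)
qed

lemma cutE:
  assumes "cut d P A B"
  obtains u v g h where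
    "u \<noteq> []" "v \<noteq> []" "bword P = u @ v" "fst d \<notin> fst ` set (bword P)"
    "bword A = u @ [d]" "bword B = inv_letter d # v"
    "embeds_via g A P" "embeds_via h B P" "g ` disc \<union> h ` disc = disc"
    "\<forall>t\<in>{0..1}. \<forall>i<length u. g (side (nsides A) i t) = side (nsides P) i t"
    "\<forall>t\<in>{0..1}. \<forall>i<length v.
       h (side (nsides B) (Suc i) t) = side (nsides P) (length u + i) t"
    "\<forall>t\<in>{0..1}. g (side (nsides A) (length u) t) = h (side (nsides B) 0 (1 - t))"
  using assms unfolding cut_def ball_conj_distrib by (elim exE conjE) (rule that)

lemma cut_fresh:
  assumes "cut d P A B"
  shows "d \<notin> set (bword P)" "inv_letter d \<notin> set (bword P)"
  by (rule cutE[OF assms]; metis fst_inv_letter image_eqI)+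

lemma cut_distinct:
  assumes "cut d P A B" "distinct (bword P)"
  shows "distinct (bword A)" "distinct (bword B)"
proof -
  obtain u v where "bword P = u @ v" "bword A = u @ [d]" "bword B = inv_letter d # v"
    by (rule cutE[OF assms(1)]) (rule that)
  then show "distinct (bword A)" "distinct (bword B)"
    using assms(2) cut_fresh[OF assms(1)] by auto
qed

lemma embeds_via_polygon_over:
  assumes "embeds_via g A P" "polygon_over M P" "distinct (bword A)"
  shows "polygon_over M A"
proof -
  have g: "continuous_on disc g" "g ` disc \<subseteq> disc" "\<And>z. z \<in> disc \<Longrightarrow> proj A z = proj P (g z)"
    using assms(1) by (auto simp: embeds_via_def)
  have "continuous_on disc (\<lambda>z. proj P (g z))"
    using assms(2) continuous_on_compose2[OF _ g(1,2), of "proj P"] unfolding polygon_over_def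
    by blast
  then have "continuous_on disc (proj A)"
    by (rule continuous_on_eq) (simp add: g(3))
  moreover have "proj A ` disc \<subseteq> M"
    using g assms(2) unfolding polygon_over_def by (auto simp: image_subset_iff)
  ultimately show ?thesis using assms(3) by (simp add: polygon_over_def)
qed

lemma cut_polygon_over:
  assumes "cut d P A B" "polygon_over M P"
  shows "polygon_over M A" "polygon_over M B"
proof -
  obtain g h where "embeds_via g A P" "embeds_via h B P"
    by (rule cutE[OF assms(1)]) (rule that)
  then show "polygon_over M A" "polygon_over M B"
    using embeds_via_polygon_over[OF _ assms(2)] cut_distinct[OF assms(1)] assms(2)
    by (simp_all add: polygon_over_def)
qed

lemma cut_same_path:
  assumes "cut d P A B" "distinct (bword P)"
  shows "s \<in> set (bword A) \<Longrightarrow> s \<noteq> d \<Longrightarrow> same_path A P s"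
    and "s \<in> set (bword B) \<Longrightarrow> s \<noteq> inv_letter d \<Longrightarrow> same_path B P s"
proof -
  obtain u v g h where c: "bword P = u @ v" "bword A = u @ [d]" "bword B = inv_letter d # v"
     "embeds_via g A P" "embeds_via h B P"
     "\<forall>t\<in>{0..1}. \<forall>i<length u. g (side (nsides A) i t) = side (nsides P) i t"
     "\<forall>t\<in>{0..1}. \<forall>i<length v.
        h (side (nsides B) (Suc i) t) = side (nsides P) (length u + i) t"
    by (rule cutE[OF assms(1)]) (rule that)
  note dist = cut_distinct[OF assms]
  show "same_path A P s" if s: "s \<in> set (bword A)" "s \<noteq> d"
  proof -
    from s c(2) obtain i where i: "i < length u" "u ! i = s" by (auto simp: in_set_conv_nth)
    have "letter_path A s = proj A \<circ> side (nsides A) i"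
      using letter_path_nth[OF dist(1), of i] i c(2) by (simp add: nth_append)
    moreover have "letter_path P s = proj P \<circ> side (nsides P) i"
      using letter_path_nth[OF assms(2), of i] i c(1) by (simp add: nth_append)
    ultimately show ?thesis
      using c(4,6) i(1) unfolding same_path_def embeds_via_def by simp
  qed
  show "same_path B P s" if s: "s \<in> set (bword B)" "s \<noteq> inv_letter d"
  proof -
    from s c(3) obtain i where i: "i < length v" "v ! i = s" by (auto simp: in_set_conv_nth)
    have "letter_path B s = proj B \<circ> side (nsides B) (Suc i)"
      using letter_path_nth[OF dist(2), of "Suc i"] i c(3) by simp
    moreover have "letter_path P s = proj P \<circ> side (nsides P) (length u + i)"
      using letter_path_nth[OF assms(2), of "length u + i"] i c(1) by (simp add: nth_append)
    ultimately show ?thesis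
      using c(5,7) i(1) unfolding same_path_def embeds_via_def by simp
  qed
qed

text \<open>The embeddings of the two pieces are homeomorphisms onto closed sets because the disc is
  compact, so the maps of the pieces paste together continuously.\<close>

lemma cut_polygon_over_converse:
  assumes "cut d P A B" "polygon_over M A" "polygon_over M B" "distinct (bword P)"
  shows "polygon_over M P"
proof -
  obtain g h where gh: "embeds_via g A P" "embeds_via h B P" "g ` disc \<union> h ` disc = disc"
    by (rule cutE[OF assms(1)]) (rule that)
  have piece: "closed (k ` disc) \<and> continuous_on (k ` disc) (proj P) \<and> proj P ` k ` disc \<subseteq> M"
    if "embeds_via k C P" "polygon_over M C" for k C
  proof -
    have k: "continuous_on disc k" "inj_on k disc" "\<And>z. z \<in> disc \<Longrightarrow> proj C z = proj P (k z)"
      using that(1) by (auto simp: embeds_via_def)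
    have C: "continuous_on disc (proj C)" "proj C ` disc \<subseteq> M"
      using that(2) by (auto simp: polygon_over_def)
    have inv: "continuous_on (k ` disc) (the_inv_into disc k)"
      using k by (intro continuous_on_inv_into) auto
    have "the_inv_into disc k ` k ` disc \<subseteq> disc"
      using k(2) by (auto simp: the_inv_into_f_f)
    then have "continuous_on (k ` disc) (\<lambda>z. proj C (the_inv_into disc k z))"
      by (rule continuous_on_compose2[OF C(1) inv])
    then have "continuous_on (k ` disc) (proj P)"
      by (rule continuous_on_eq) (use k in \<open>auto simp: the_inv_into_f_f\<close>)
    moreover have "closed (k ` disc)"
      using k(1) by (intro compact_imp_closed compact_continuous_image) auto
    ultimately show ?thesis
      using k(3) C(2) by (auto simp: image_subset_iff)
  qed
  have "continuous_on (g ` disc \<union> h ` disc) (proj P)"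
    using piece[OF gh(1) assms(2)] piece[OF gh(2) assms(3)] by (intro continuous_on_closed_Un) auto
  moreover have "proj P ` (g ` disc \<union> h ` disc) \<subseteq> M"
    using piece[OF gh(1) assms(2)] piece[OF gh(2) assms(3)] by blast
  ultimately show ?thesis
    using gh(3) assms(4) by (simp add: polygon_over_def)
qed

text \<open>A gluing is a cut read backwards, up to the choice of initial vertices.\<close>

lemma glue_polygon_over:
  assumes "glue a A B P" "polygon_over M A" "polygon_over M B" "distinct (bword P)"
  shows "polygon_over M P"
  using assms unfolding glue_def
  by (meson cut_polygon_over_converse rotated_distinct rotated_polygon_over)

lemma glue_same_path:
  assumes "glue a A B P" "distinct (bword A)" "distinct (bword B)" "distinct (bword P)"
  shows "s \<in> set (bword A) \<Longrightarrow> s \<noteq> a \<Longrightarrow> same_path P A s"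
    and "s \<in> set (bword B) \<Longrightarrow> s \<noteq> inv_letter a \<Longrightarrow> same_path P B s"
proof -
  obtain A' B' P' where r: "rotated A A'" "rotated B B'" "rotated P' P" and c: "cut a P' A' B'"
    using assms(1) unfolding glue_def by blast
  have d: "distinct (bword P')" using assms(4) rotated_distinct[OF r(3)] by simp
  have sub: "set (bword A') - {a} \<subseteq> set (bword P')"
    "set (bword B') - {inv_letter a} \<subseteq> set (bword P')"
    by (rule cutE[OF c]; auto)+
  show "same_path P A s" if s: "s \<in> set (bword A)" "s \<noteq> a"
  proof -
    have s': "s \<in> set (bword A')" using s rotated_set_bword[OF r(1)] by simp
    have "same_path P P' s"
      using rotated_same_path[OF r(3) d] s s' sub by blast
    moreover have "same_path P' A' s"
      using cut_same_path(1)[OF c d s' s(2)] by (rule same_path_sym)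
    moreover have "same_path A' A s"
      using rotated_same_path[OF r(1) assms(2) s(1)] .
    ultimately show ?thesis by (blast intro: same_path_trans)
  qed
  show "same_path P B s" if s: "s \<in> set (bword B)" "s \<noteq> inv_letter a"
  proof -
    have s': "s \<in> set (bword B')" using s rotated_set_bword[OF r(2)] by simp
    have "same_path P P' s"
      using rotated_same_path[OF r(3) d] s s' sub by blast
    moreover have "same_path P' B' s"
      using cut_same_path(2)[OF c d s' s(2)] by (rule same_path_sym)
    moreover have "same_path B' B s"
      using rotated_same_path[OF r(2) assms(3) s(1)] .
    ultimately show ?thesis by (blast intro: same_path_trans)
  qed
qed

section \<open>The homotopy class of a diagonal\<close>

lemma cut_diagonal_reverse:
  assumes "cut d P A B" "distinct (bword P)" "t \<in> {0..1}"
  shows "letter_path B (inv_letter d) t = reversepath (letter_path A d) t"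
proof -
  obtain u v g h where c: "bword A = u @ [d]" "bword B = inv_letter d # v"
     "embeds_via g A P" "embeds_via h B P"
     "\<forall>t\<in>{0..1}. g (side (nsides A) (length u) t) = h (side (nsides B) 0 (1 - t))"
    by (rule cutE[OF assms(1)]) (rule that)
  note dist = cut_distinct[OF assms(1,2)]
  have "letter_path A d = proj A \<circ> side (nsides A) (length u)"
    using letter_path_nth[OF dist(1), of "length u"] c(1) by simp
  moreover have "letter_path B (inv_letter d) = proj B \<circ> side (nsides B) 0"
    using letter_path_nth[OF dist(2), of 0] c(2) by simp
  ultimately show ?thesis
    using c(3-5) assms(3) by (simp add: embeds_via_def reversepath_def)
qed

text \<open>In each piece the diagonal and the remaining sides bound a disc, and both are therefore
  homotopic to the same chord, traversed in opposite directions.\<close>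

lemma cut_diagonal_homotopic:
  assumes c: "cut d P A B" and P: "polygon_over M P"
    and A: "bword A = u @ [d]" and B: "bword B = inv_letter d # v"
  shows "homotopic_paths M (letter_path A d) (reversepath (edge_path P u))"
    and "homotopic_paths M (letter_path A d) (edge_path P v)"
proof -
  have w: "bword P = u @ v" and ne: "u \<noteq> []" "v \<noteq> []"
    by (rule cutE[OF c]; use A B in auto)+
  have d: "distinct (bword P)" using P by (simp add: polygon_over_def)
  have nd: "s \<noteq> d" "s \<noteq> inv_letter d" if "s \<in> set (bword P)" for s
    using cut_fresh[OF c] that by auto
  note AB = cut_polygon_over[OF c P]
  have walks: "walk M A u" "walk M B v"
    using walk_bword_factor[OF AB(1), of "[]" u "[d]"]
      walk_bword_factor[OF AB(2), of "[inv_letter d]" v "[]"] A B by auto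
  have Pu: "homotopic_paths M (edge_path P u) (edge_path A u)"
    using walk_edge_path[OF ne(1) walks(1)]
      edge_path_cong[OF ne(1), of A P] cut_same_path(1)[OF c d] nd w A
    by (intro homotopic_paths_sym[OF homotopic_paths_eq]) auto
  have Pv: "homotopic_paths M (edge_path B v) (edge_path P v)"
    using walk_edge_path[OF ne(2) walks(2)]
      edge_path_cong[OF ne(2), of B P] cut_same_path(2)[OF c d] nd w B
    by (intro homotopic_paths_eq) auto
  show "homotopic_paths M (letter_path A d) (reversepath (edge_path P u))"
  proof -
    let ?V = "\<lambda>k. side (nsides A) k 0"
    have "homotopic_paths M (edge_path A u) (proj A \<circ> linepath (?V 0) (?V (length u)))"
      using edge_path_homotopic_chord[OF AB(1), of "[]" u "[d]"] A ne by simp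
    then have "homotopic_paths M (reversepath (edge_path P u))
        (reversepath (proj A \<circ> linepath (?V 0) (?V (length u))))"
      by (rule homotopic_paths_reversepath_D[OF homotopic_paths_trans[OF Pu]])
    moreover have "reversepath (proj A \<circ> linepath (?V 0) (?V (length u)))
        = proj A \<circ> linepath (?V (length u)) (?V 0)"
      by (metis path_compose_reversepath reversepath_linepath)
    moreover have "homotopic_paths M (letter_path A d) (proj A \<circ> linepath (?V (length u)) (?V 0))"
      using edge_path_homotopic_chord[OF AB(1), of u "[d]" "[]"] A side_full_turn[of "nsides A"]
      by simp
    ultimately show ?thesis
      by (metis homotopic_paths_sym homotopic_paths_trans)
  qed
  show "homotopic_paths M (letter_path A d) (edge_path P v)"
  proof -
    let ?V = "\<lambda>k. side (nsides B) k 0"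
    have "letter_path A d t = reversepath (letter_path B (inv_letter d)) t" if "t \<in> {0..1}" for t
      using cut_diagonal_reverse[OF c d, of "1 - t"] that by (simp add: reversepath_def)
    then have "homotopic_paths M (letter_path A d) (reversepath (letter_path B (inv_letter d)))"
      using walk_letter[OF AB(1), of d] A by (intro homotopic_paths_eq) auto
    moreover have "homotopic_paths M (letter_path B (inv_letter d)) (proj B \<circ> linepath (?V 0) (?V 1))"
      using edge_path_homotopic_chord[OF AB(2), of "[]" "[inv_letter d]" v] B by simp
    then have "homotopic_paths M (reversepath (letter_path B (inv_letter d)))
        (proj B \<circ> linepath (?V 1) (?V 0))"
      by (metis homotopic_paths_reversepath path_compose_reversepath reversepath_linepath)
    moreover have "homotopic_paths M (edge_path B v) (proj B \<circ> linepath (?V 1) (?V 0))"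
      using edge_path_homotopic_chord[OF AB(2), of "[inv_letter d]" v "[]"] B ne
        side_full_turn[of "nsides B"] by simp
    ultimately show ?thesis
      using Pv by (metis homotopic_paths_sym homotopic_paths_trans)
  qed
qed

section \<open>Handle normalization\<close>

theorem proposition4p2:
  fixes P P' :: "('l, 's::topological_space) polygon"
    and M :: "'s set"
    and Q R S T U :: "'l sletter list"
    and a b d x y :: "'l sletter"
  assumes "quotient_surface P M"
    and "cyc_reduced (bword P)"
    and "bword P = Q @ [a] @ R @ [b] @ S @ [inv_letter a] @ T @ [inv_letter b] @ U"
    and "handle_normalization P Q a R b S T U d x y P'"
    and "bword P' = Q @ T @ S @ R @ U @ [y, x, inv_letter y, inv_letter x]"
  shows "homotopic_paths M (edge_path P' [x])
           (edge_path P (Q @ T @ [inv_letter b] @ U)) \<and>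
         homotopic_paths M (edge_path P' [y])
           (edge_path P (inv_word U @ inv_word R @ [inv_letter a] @ T @ [inv_letter b] @ U))"
proof -
  let ?v = "[inv_letter a] @ T @ [inv_letter b] @ U"
  obtain A1 B1 P1 A2 B2 P2 A3 B3 where
    cut1: "cut d P A1 B1" and glue1: "glue a A1 B1 P1" and
    cut2: "cut x P1 A2 B2" and glue2: "glue b A2 B2 P2" and
    cut3: "cut y P2 A3 B3" and glue3: "glue d B3 A3 P'" and
    words: "bword A1 = Q @ [a] @ R @ [b] @ S @ [d]"
      "bword B1 = [inv_letter d, inv_letter a] @ T @ [inv_letter b] @ U"
      "bword P1 = [inv_letter d] @ R @ [b] @ S @ [d] @ Q @ T @ [inv_letter b] @ U"
      "bword A2 = [inv_letter d] @ R @ [b] @ S @ [d, x]"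
      "bword B2 = [inv_letter x] @ Q @ T @ [inv_letter b] @ U"
      "bword P2 = [inv_letter d] @ R @ U @ [inv_letter x] @ Q @ T @ S @ [d, x]"
      "bword A3 = [inv_letter d] @ R @ U @ [y]"
      "bword B3 = [inv_letter y, inv_letter x] @ Q @ T @ S @ [d, x]"
    using assms(4) unfolding handle_normalization_def by auto
  note wP = assms(3) and wP' = assms(5)
  have over: "polygon_over M P" using assms(1) by (rule quotient_surface_imp_polygon_over)
  have dist: "distinct (bword P)" using over by (simp add: polygon_over_def)
  note fresh_d = cut_fresh[OF cut1] and fresh_x = cut_fresh[OF cut2]
    and fresh_y = cut_fresh[OF cut3]
  have dist1: "distinct (bword P1)"
    using dist fresh_d unfolding wP words
    by (simp add: Int_Un_distrib) (metis Int_commute)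
  have over1: "polygon_over M P1"
    using glue_polygon_over[OF glue1 cut_polygon_over[OF cut1 over] dist1] .
  have dist2: "distinct (bword P2)"
    using dist1 fresh_x unfolding words
    by (simp add: Int_Un_distrib) (metis Int_commute)
  have over2: "polygon_over M P2"
    using glue_polygon_over[OF glue2 cut_polygon_over[OF cut2 over1] dist2] .
  have dist': "distinct (bword P')"
    using dist2 fresh_y unfolding words wP'
    by (simp add: Int_Un_distrib) (metis Int_commute)
  note dAB1 = cut_distinct[OF cut1 dist] and dAB2 = cut_distinct[OF cut2 dist1]
    and dAB3 = cut_distinct[OF cut3 dist2]
  note c1 = cut_same_path[OF cut1 dist] and c2 = cut_same_path[OF cut2 dist1]
    and c3 = cut_same_path[OF cut3 dist2]
  note g1 = glue_same_path[OF glue1 dAB1 dist1] and g2 = glue_same_path[OF glue2 dAB2 dist2]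
    and g3 = glue_same_path[OF glue3 dAB3(2,1) dist']
  note trans = same_path_trans

  have P1_P: "same_path P1 P s" if s_in: "s \<in> set (Q @ R @ S @ T @ [b, inv_letter b] @ U)" for s
  proof -
    have s: "s \<in> set (bword P)" "s \<noteq> a" "s \<noteq> inv_letter a"
      using s_in dist unfolding wP by auto
    then consider "s \<in> set (bword A1)" | "s \<in> set (bword B1)"
      using s_in unfolding words by auto
    then show ?thesis
      using trans[OF g1(1) c1(1)] trans[OF g1(2) c1(2)] s fresh_d by cases metis+
  qed
  have P2_P1: "same_path P2 P1 s" if s_in: "s \<in> set ([d, inv_letter d] @ Q @ R @ S @ T @ U)" for s
  proof -
    have s: "s \<in> set (bword P1)" "s \<noteq> b" "s \<noteq> inv_letter b"
      using s_in dist1 unfolding words by auto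
    then consider "s \<in> set (bword A2)" | "s \<in> set (bword B2)"
      using s_in unfolding words by auto
    then show ?thesis
      using trans[OF g2(1) c2(1)] trans[OF g2(2) c2(2)] s fresh_x by cases metis+
  qed

  have x: "homotopic_paths M (edge_path P' [x]) (edge_path P (Q @ T @ [inv_letter b] @ U))"
  proof -
    have "x \<noteq> d" "x \<noteq> b" "x \<noteq> inv_letter y"
      using fresh_x fresh_y unfolding words by auto
    then have "same_path P' B3 x" "same_path B3 P2 x" "same_path P2 A2 x"
      using g3(1) c3(2) g2(1) unfolding words by auto
    then have same: "same_path A2 P' x"
      by (blast intro: trans same_path_sym)
    have hom: "homotopic_paths M (letter_path A2 x) (edge_path P1 (Q @ T @ [inv_letter b] @ U))"
      using cut_diagonal_homotopic(2)[OF cut2 over1] words by simp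
    have "homotopic_paths M (letter_path P' x) (letter_path A2 x)"
      using homotopic_paths_imp_path[OF hom] homotopic_paths_imp_subset[OF hom] same
      by (intro homotopic_paths_sym[OF homotopic_paths_eq]) (auto simp: same_path_def)
    moreover note hom
    moreover have "homotopic_paths M (edge_path P1 (Q @ T @ [inv_letter b] @ U))
        (edge_path P (Q @ T @ [inv_letter b] @ U))"
      using homotopic_paths_imp_path[OF hom] homotopic_paths_imp_subset[OF hom]
      by (intro homotopic_paths_eq edge_path_cong P1_P) auto
    ultimately show ?thesis
      by (auto intro: homotopic_paths_trans)
  qed

  have walk_v: "walk M P ?v"
    using walk_bword_factor[OF over, of "Q @ [a] @ R @ [b] @ S" ?v "[]"] wP by simp
  note ev = walk_edge_path[OF _ walk_v, simplified]
  \<comment> \<open>After the first gluing \<open>d\<inverse>\<close> is the side inherited from the second piece, hence the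
    diagonal of the first cut run backwards.\<close>
  have d: "homotopic_paths M (letter_path P2 (inv_letter d)) (reversepath (edge_path P ?v))"
  proof -
    have "same_path P1 B1 (inv_letter d)"
      using g1(2)[of "inv_letter d"] fresh_d wP words by auto
    then have same: "same_path B1 P2 (inv_letter d)"
      using P2_P1[of "inv_letter d"] by (auto simp: same_path_def)
    have "homotopic_paths M (letter_path A1 d) (edge_path P ?v)"
      using cut_diagonal_homotopic(2)[OF cut1 over, of "Q @ [a] @ R @ [b] @ S" ?v] words by simp
    then have hom: "homotopic_paths M (reversepath (letter_path A1 d)) (reversepath (edge_path P ?v))"
      by (rule homotopic_paths_reversepath_D)
    have "homotopic_paths M (reversepath (letter_path A1 d)) (letter_path P2 (inv_letter d))"
      using homotopic_paths_imp_path[OF hom] homotopic_paths_imp_subset[OF hom] same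
        cut_diagonal_reverse[OF cut1 dist]
      by (intro homotopic_paths_eq) (auto simp: same_path_def)
    then show ?thesis
      using hom by (blast intro: homotopic_paths_sym homotopic_paths_trans)
  qed

  have y: "homotopic_paths M (letter_path P' y)
      (reversepath (edge_path P2 (inv_letter d # R @ U)))"
  proof -
    have "y \<noteq> inv_letter d"
      using fresh_y unfolding words by auto
    then have same: "same_path A3 P' y"
      using same_path_sym[OF g3(2)[of y]] unfolding words by simp
    have hom: "homotopic_paths M (letter_path A3 y)
        (reversepath (edge_path P2 (inv_letter d # R @ U)))"
      using cut_diagonal_homotopic(1)[OF cut3 over2] words by simp
    have "homotopic_paths M (letter_path P' y) (letter_path A3 y)"
      using homotopic_paths_imp_path[OF hom] homotopic_paths_imp_subset[OF hom] same
      by (intro homotopic_paths_sym[OF homotopic_paths_eq]) (auto simp: same_path_def)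
    then show ?thesis
      using hom by (rule homotopic_paths_trans)
  qed
  \<comment> \<open>The empty word has no edge path, so the case of empty \<open>R\<close> and \<open>U\<close> is separate.\<close>
  have "homotopic_paths M (reversepath (edge_path P2 (inv_letter d # R @ U)))
      (edge_path P (inv_word (R @ U) @ ?v))"
  proof (cases "R @ U = []")
    case True
    then show ?thesis
      using homotopic_paths_reversepath_D[OF d] by simp
  next
    case False
    let ?w = "R @ U"
    have walk2: "walk M P2 (inv_letter d # ?w)"
      using walk_bword_factor[OF over2, of "[]" "inv_letter d # R @ U"
          "[inv_letter x] @ Q @ T @ S @ [d, x]"] words by simp
    have same: "same_path P2 P s" if "s \<in> set ?w" for s
      using trans[OF P2_P1 P1_P, of s] that by auto
    have walk_w: "walk M P ?w"
      using walk_cong[of M P2 ?w P] walk2 same by (simp add: walk_Cons)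
    have inv: "homotopic_paths M (letter_path P (inv_letter s)) (reversepath (letter_path P s))"
      if "s \<in> set ?w" for s
      using letter_path_inv_letter[OF assms(1), of s] that wP by auto
    have walk_i: "walk M P (inv_word ?w)"
      by (rule walk_inv_word[OF walk_w inv])
    have joint: "pathfinish (letter_path P2 (inv_letter d)) = pathstart (letter_path P2 (hd ?w))"
      using walk2 False by (simp add: walk_Cons)
    note e2 = walk_edge_path[OF False, of M P2] and ew = walk_edge_path[OF False walk_w]
    have w2: "homotopic_paths M (edge_path P ?w) (edge_path P2 ?w)"
      using ew(1,2) False same
      by (intro homotopic_paths_eq edge_path_cong) (auto intro: same_path_sym)
    have i: "homotopic_paths M (edge_path P (inv_word ?w)) (reversepath (edge_path P2 ?w))"
      using edge_path_inv_word[OF False walk_w inv] w2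
      by (metis homotopic_paths_reversepath homotopic_paths_trans)
    have v: "homotopic_paths M (edge_path P ?v) (reversepath (letter_path P2 (inv_letter d)))"
      using homotopic_paths_sym[OF homotopic_paths_reversepath_D[OF d]]
      by (simp only: reversepath_reversepath)
    have meet: "pathfinish (edge_path P (inv_word ?w)) = pathstart (edge_path P ?v)"
      using homotopic_paths_imp_pathfinish[OF i] homotopic_paths_imp_pathstart[OF v]
        e2(3) walk2 joint by (simp add: walk_Cons)
    have "walk M P (inv_word ?w @ ?v)"
      using walk_i walk_v meet walk_edge_path(4)[OF _ walk_i] ev(3) False
      by (simp only: walk_append) simp
    then have "homotopic_paths M (edge_path P (inv_word ?w @ ?v))
        (edge_path P (inv_word ?w) +++ edge_path P ?v)"
      using False by (intro edge_path_append) simp_all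
    also have "homotopic_paths M (edge_path P (inv_word ?w) +++ edge_path P ?v)
        (reversepath (edge_path P2 ?w) +++ reversepath (letter_path P2 (inv_letter d)))"
      using i v meet by (rule homotopic_paths_join)
    also have "\<dots> = reversepath (edge_path P2 (inv_letter d # ?w))"
      using False joint e2(3) walk2
      by (simp add: edge_path_Cons reversepath_joinpaths walk_Cons)
    finally show ?thesis by (rule homotopic_paths_sym)
  qed
  then have "homotopic_paths M (edge_path P' [y]) (edge_path P (inv_word U @ inv_word R @ ?v))"
    using homotopic_paths_trans[OF y] by (simp add: inv_word_append)
  with x show ?thesis by blast
qed

end
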